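(* Let $R$ be an arbitrary unital associative and commutative ring such that $3$ is invertible in $R$. Let $A$ be a unital associative $R$-algebra generated by a set $X$ and let $n \ge 2$. Then \[ [a_1, a_2, \dots , a_n] = 0 \quad \text{for all } a_1, \dots, a_n \in A \] if, and only if, \[ [y_1, y_2, \dots , y_n] = 0 \quad \text{for all } y_1, y_n \in X \text{ and all } y_2, \dots , y_{n-1} \in X \cup X^2 . \]
   Context: Here $3 = 1+1+1 \in R$, and $X^2 = \{ x_1 x_2 \mid x_1, x_2 \in X \}$ is the set of all products of two elements of $X$. Commutators are additive and left-normed: $[a_1,a_2] = a_1a_2 - a_2a_1$ and $[a_1, \dots, a_{m-1}, a_m] = \bigl[[a_1,\dots,a_{m-1}],a_m\bigr]$ for $m>2$. "Generated by $X$" means generated as a unital $R$-algebra. *)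

theory Defs
  imports Main "HOL.Hull"
begin

text \<open>
  Rings are types, but of sort \<open>{ring, monoid_mult}\<close> rather than \<open>ring_1\<close> (and likewise
  \<open>{comm_ring, comm_monoid_mult}\<close> rather than \<open>comm_ring_1\<close>): the \<open>_1\<close> classes, and hence the
  locale \<open>module\<close> of \<open>HOL.Modules\<close>, require \<open>0 \<noteq> 1\<close> and would exclude the zero ring.
\<close>

locale unital_algebra =
  fixes scale :: "'r::{comm_ring, comm_monoid_mult} \<Rightarrow> 'a::{ring, monoid_mult} \<Rightarrow> 'a"
    (infixr \<open>*s\<close> 75)
  assumes scale_right_distrib: "r *s (a + b) = r *s a + r *s b"
    and scale_left_distrib: "(r + s) *s a = r *s a + s *s a"
    and scale_scale: "r *s (s *s a) = (r * s) *s a"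
    and scale_one: "1 *s a = a"
    and scale_mult_left: "(r *s a) * b = r *s (a * b)"
    and scale_mult_right: "a * (r *s b) = r *s (a * b)"

definition subalgebra :: "('r \<Rightarrow> 'a::{ring, monoid_mult} \<Rightarrow> 'a) \<Rightarrow> 'a set \<Rightarrow> bool"
  where "subalgebra scale S \<longleftrightarrow> 0 \<in> S \<and> 1 \<in> S \<and>
    (\<forall>a\<in>S. \<forall>b\<in>S. a + b \<in> S \<and> a * b \<in> S) \<and> (\<forall>r. \<forall>a\<in>S. scale r a \<in> S)"

text \<open>The algebra generated by \<open>X\<close> is \<open>subalgebra scale hull X\<close>, the least unital subalgebra
  containing \<open>X\<close>.\<close>

definition generates :: "('r \<Rightarrow> 'a::{ring, monoid_mult} \<Rightarrow> 'a) \<Rightarrow> 'a set \<Rightarrow> bool"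
  where "generates scale X \<longleftrightarrow> subalgebra scale hull X = UNIV"

definition commutator :: "'a::ring \<Rightarrow> 'a \<Rightarrow> 'a"
  where "commutator a b = a * b - b * a"

text \<open>\<open>left_normed [a\<^sub>1, \<dots>, a\<^sub>m]\<close> is \<open>[\<dots>[[a\<^sub>1, a\<^sub>2], a\<^sub>3], \<dots>, a\<^sub>m]\<close>; it is only meaningful for
  lists of length at least 2.\<close>

definition left_normed :: "'a::ring list \<Rightarrow> 'a"
  where "left_normed as = foldl commutator (hd as) (tl as)"

lemma left_normed_pair: "left_normed [a, b] = a * b - b * a"
  by (simp add: left_normed_def commutator_def)

lemma left_normed_snoc:
  "as \<noteq> [] \<Longrightarrow> left_normed (as @ [b]) = commutator (left_normed as) b"
  by (cases as) (simp_all add: left_normed_def)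

definition pair_products :: "'a::times set \<Rightarrow> 'a set"
  where "pair_products X = {x\<^sub>1 * x\<^sub>2 | x\<^sub>1 x\<^sub>2. x\<^sub>1 \<in> X \<and> x\<^sub>2 \<in> X}"

end

theory Submission
  imports Defs
begin

text \<open>
  In these comments \<open>[a, b]\<close> is the commutator, denoted \<open>a \<diamondop> b\<close> in formulas, and
  \<open>Y = X \<union> X\<^sup>2\<close> is the set of entries allowed in the middle.  The nontrivial direction goes by
  induction on \<open>n\<close> in steps of two, and for the induction to work every "\<open>= 0\<close>" is read as
  "lies in a given two-sided ideal \<open>I\<close>".

  Suppose that \<open>n \<ge> 4\<close> and that all test commutators of length \<open>n\<close> lie in \<open>I\<close>, and let
  \<open>z = [g, x]\<close> be a test commutator of length \<open>n - 2\<close> with last entry \<open>x \<in> X\<close>.  Two facts about \<open>z\<close>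
  are enough, both modulo \<open>I\<close>:
  (a) \<open>[z, p, q] = 0\<close> for all \<open>p\<close>, \<open>q\<close>, and
  (b) \<open>z [p, q, r] = 0\<close> for all \<open>p\<close>, \<open>q\<close>, \<open>r\<close>.
  They imply \<open>[a z b, c, d] = 0\<close> for all \<open>a\<close>, \<open>b\<close>, \<open>c\<close>, \<open>d\<close> (lemma \<open>sandwich\<close>).  By the induction
  hypothesis the ideal generated by the elements \<open>z\<close> contains all commutators of length \<open>n - 2\<close>,
  hence all commutators of length \<open>n\<close> vanish modulo \<open>I\<close>.

  Fact (b) is a consequence of \<open>[g, y, p, q] = 0\<close> for \<open>y \<in> Y\<close> (lemma \<open>annihilates_triple\<close>).  Expanding
  \<open>[g, a b, d, e] = 0\<close> with \<open>a\<close>, \<open>b \<in> X\<close> gives the exchange rule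
  \<open>[g, a] [b, d, e] = - [g, b] [a, d, e]\<close>.  If all entries are in \<open>X\<close>, then \<open>[g, a] [b, d, e]\<close> is
  alternating in \<open>a\<close>, \<open>b\<close>, \<open>d\<close>, and the Jacobi identities for the triples among the four letters force
  it to be killed by \<open>3\<close>; this is where \<open>1/3\<close> enters.  The products \<open>[g, c] [a, p q, b]\<close> with a middle
  entry from \<open>X\<^sup>2\<close> have enough symmetries to vanish as well.  The \<open>t\<close> with \<open>[g, c] A t = 0\<close> for all
  \<open>c \<in> X\<close> form a two-sided ideal, so the case \<open>n = 3\<close> of the theorem, applied to that ideal, extends (b)
  from these special triples to all triple commutators.

  Fact (a), and more generally \<open>[g, y, p, q] = 0\<close> for \<open>y \<in> Y\<close>, holds because \<open>[w, p]\<close> is central for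
  all \<open>p\<close> as soon as it is central for all \<open>p \<in> Y\<close> (lemma \<open>central_from_pairs\<close>); for \<open>w = [g, y]\<close> and
  \<open>p \<in> Y\<close> it commutes with \<open>X\<close> by assumption, hence with everything.  This extension from \<open>Y\<close> is proved
  letter by letter along words.  The obstruction to each step is a product of a triple commutator and
  some \<open>[w, p]\<close>, and it vanishes by the argument for (b), applied to \<open>w\<close> in place of \<open>g\<close>.  The cases
  \<open>n = 2\<close> and \<open>n = 3\<close> are direct.
\<close>

section \<open>Two-sided ideals and elements that are second central modulo them\<close>

notation commutator (infixl "\<diamondop>" 75)

lemma commutator_mult_right: "c \<diamondop> (a * b) = c \<diamondop> a * b + a * c \<diamondop> b"
  by (simp add: commutator_def algebra_simps)

locale two_sided_ideal =
  fixes I :: "'a::{ring, monoid_mult} set"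
  assumes zero_mem: "0 \<in> I"
    and add_mem: "\<lbrakk>s \<in> I; t \<in> I\<rbrakk> \<Longrightarrow> s + t \<in> I"
    and left_mem: "t \<in> I \<Longrightarrow> a * t \<in> I"
    and right_mem: "t \<in> I \<Longrightarrow> t * a \<in> I"
begin

lemma minus_mem: "t \<in> I \<Longrightarrow> - t \<in> I"
  using left_mem[of t "- 1"] by simp

lemma diff_mem: "\<lbrakk>s \<in> I; t \<in> I\<rbrakk> \<Longrightarrow> s - t \<in> I"
  using add_mem[of s "- t"] minus_mem[of t] by simp

lemma commutator_right: "t \<in> I \<Longrightarrow> t \<diamondop> a \<in> I"
  unfolding commutator_def by (intro diff_mem left_mem right_mem)

lemma commutator_swap: "a \<diamondop> b \<in> I \<Longrightarrow> b \<diamondop> a \<in> I"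
  using minus_mem[of "a \<diamondop> b"] by (simp add: commutator_def)

text \<open>
  The hypothesis \<open>[u, p, q] \<in> I\<close> of the next lemmas says that \<open>u\<close> lies in the second centre modulo
  \<open>I\<close>.
\<close>

lemma second_centre_derived:
  assumes "\<And>p q. u \<diamondop> p \<diamondop> q \<in> I"
  shows "u \<diamondop> (x \<diamondop> y) \<in> I"
proof -
  have "u \<diamondop> (x \<diamondop> y) = u \<diamondop> x \<diamondop> y - u \<diamondop> y \<diamondop> x"
    by (simp add: commutator_def algebra_simps)
  then show ?thesis using assms diff_mem by simp
qed

text \<open>
  Since \<open>u\<close> commutes with \<open>[x, c b] = [x, c] b + c [x, b]\<close> and with both commutators on the right,
  only the terms in which \<open>u\<close> meets \<open>b\<close> or \<open>c\<close> survive.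
\<close>

lemma second_centre_swap:
  assumes u: "\<And>p q. u \<diamondop> p \<diamondop> q \<in> I"
  shows "u \<diamondop> b * x \<diamondop> c + u \<diamondop> c * x \<diamondop> b \<in> I"
proof -
  have "u \<diamondop> b * x \<diamondop> c + u \<diamondop> c * x \<diamondop> b =
      u \<diamondop> (x \<diamondop> (c * b)) - u \<diamondop> (x \<diamondop> c) * b - c * u \<diamondop> (x \<diamondop> b) + u \<diamondop> b \<diamondop> (x \<diamondop> c)"
    by (simp add: commutator_def algebra_simps)
  moreover have "\<dots> \<in> I"
    by (intro add_mem diff_mem left_mem right_mem second_centre_derived u)
  ultimately show ?thesis by simp
qed

text \<open>
  Replace \<open>b\<close> by \<open>b d\<close> in the previous lemma.  Besides other instances of it and a term with the factor
  \<open>[u, c, b]\<close>, the Leibniz expansion contains only \<open>[u, b] [x, c, d]\<close>, which therefore lies in \<open>I\<close>.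
\<close>

lemma second_centre_triple:
  assumes u: "\<And>p q. u \<diamondop> p \<diamondop> q \<in> I"
  shows "u \<diamondop> b * x \<diamondop> c \<diamondop> d \<in> I"
proof -
  let ?R = "\<lambda>b c. u \<diamondop> b * x \<diamondop> c + u \<diamondop> c * x \<diamondop> b"
  have "u \<diamondop> b * x \<diamondop> c \<diamondop> d =
      ?R b c * d + b * ?R d c + u \<diamondop> c \<diamondop> b * x \<diamondop> d - ?R (b * d) c"
    by (simp add: commutator_def algebra_simps)
  moreover have "\<dots> \<in> I"
    by (intro add_mem diff_mem left_mem right_mem[OF u] right_mem[OF second_centre_swap] second_centre_swap u)
  ultimately show ?thesis by simp
qed

text \<open>
  Moving \<open>z\<close> to one side costs a term with the central factor \<open>[z, b]\<close>, which
  lemma \<open>second_centre_triple\<close> handles.  In the Leibniz expansion of the rest, the terms with one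
  commutator on \<open>z\<close> cancel by lemma \<open>second_centre_swap\<close>, those with two vanish, and those with none
  are triple commutators times \<open>z\<close>.
\<close>

lemma sandwich:
  assumes z: "\<And>p q. z \<diamondop> p \<diamondop> q \<in> I"
    and ann: "\<And>p q r. z * p \<diamondop> q \<diamondop> r \<in> I"
  shows "(a * z * b) \<diamondop> c \<diamondop> d \<in> I"
proof -
  have "(a * z * b) \<diamondop> c \<diamondop> d =
      z * (a * b) \<diamondop> c \<diamondop> d - z \<diamondop> ((a * b) \<diamondop> c \<diamondop> d)
      + (z \<diamondop> c * (a * b) \<diamondop> d + z \<diamondop> d * (a * b) \<diamondop> c)
      - z \<diamondop> c \<diamondop> ((a * b) \<diamondop> d) - z \<diamondop> d \<diamondop> ((a * b) \<diamondop> c)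
      + a * b * z \<diamondop> c \<diamondop> d
      + (z \<diamondop> b * a \<diamondop> c \<diamondop> d - z \<diamondop> b \<diamondop> (a \<diamondop> c \<diamondop> d))
      + a \<diamondop> c * z \<diamondop> b \<diamondop> d + a \<diamondop> d * z \<diamondop> b \<diamondop> c + a * z \<diamondop> b \<diamondop> c \<diamondop> d"
    by (simp add: commutator_def algebra_simps)
  moreover have "\<dots> \<in> I"
    by (intro add_mem diff_mem ann second_centre_derived[OF z] second_centre_swap[OF z] z left_mem
        second_centre_triple[OF z] commutator_right[OF z])
  ultimately show ?thesis by simp
qed

text \<open>
  Modulo \<open>I\<close> the product \<open>h a b d e = u a [b, d, e]\<close> is alternating in \<open>a\<close>, \<open>b\<close>, \<open>d\<close>.  Hence, up to sign,
  it depends only on which of the four letters stands last.  The Jacobi identities, one for each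
  choice of the first letter, make these four values linear combinations of each other; adding those
  for \<open>a\<close> and \<open>d\<close>, subtracting that for \<open>b\<close> and adding twice that for \<open>e\<close> leaves \<open>3 h a b d e\<close>.
\<close>

lemma alternating_Jacobi:
  fixes u :: "'a \<Rightarrow> 'a"
  assumes third: "\<And>t. t + t + t \<in> I \<Longrightarrow> t \<in> I"
    and swap: "\<And>a b d e. \<lbrakk>a \<in> X; b \<in> X\<rbrakk> \<Longrightarrow> u a * b \<diamondop> d \<diamondop> e + u b * a \<diamondop> d \<diamondop> e \<in> I"
    and X: "a \<in> X" "b \<in> X" "d \<in> X" "e \<in> X"
  shows "u a * b \<diamondop> d \<diamondop> e \<in> I"
proof (rule third)
  define h where "h x y z t = u x * y \<diamondop> z \<diamondop> t" for x y z t
  define s where "s x y z t = h x y z t + h y x z t" for x y z t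
  \<comment> \<open>The defects \<open>s\<close> collect what is needed to bring each term of the combination of Jacobi identities
    described above into alternating normal form.\<close>
  have "h a b d e + h a b d e + h a b d e =
      s a b d e - s a b e d - s a d b e - s b d e a + s a d e b
      - (s a e b d + s b e d a + s a d e b + s d e a b)
      - (s a e b d + s b e d a + s a d e b + s d e a b)"
    by (simp add: s_def h_def commutator_def algebra_simps)
  moreover have "s x y z t \<in> I" if "x \<in> X" "y \<in> X" for x y z t
    using swap that by (simp add: s_def h_def)
  ultimately show "u a * b \<diamondop> d \<diamondop> e + u a * b \<diamondop> d \<diamondop> e + u a * b \<diamondop> d \<diamondop> e \<in> I"
    unfolding h_def[symmetric] using X by (simp add: add_mem diff_mem)
qed

text \<open>
  Expand \<open>[w, a b, d, e] = [[w, a] b + a [w, b], d, e]\<close>: the terms with one commutator on each factor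
  cancel in pairs by lemma \<open>second_centre_swap\<close>.
\<close>

lemma second_centre_exchange:
  assumes za: "\<And>p q. w \<diamondop> a \<diamondop> p \<diamondop> q \<in> I"
    and zb: "\<And>p q. w \<diamondop> b \<diamondop> p \<diamondop> q \<in> I"
    and zab: "\<And>p q. w \<diamondop> (a * b) \<diamondop> p \<diamondop> q \<in> I"
  shows "w \<diamondop> a * b \<diamondop> d \<diamondop> e + w \<diamondop> b * a \<diamondop> d \<diamondop> e \<in> I"
proof -
  have "w \<diamondop> a * b \<diamondop> d \<diamondop> e + w \<diamondop> b * a \<diamondop> d \<diamondop> e =
      w \<diamondop> (a * b) \<diamondop> d \<diamondop> e - w \<diamondop> a \<diamondop> d \<diamondop> e * b - a * w \<diamondop> b \<diamondop> d \<diamondop> e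
      - (w \<diamondop> a \<diamondop> d * b \<diamondop> e + w \<diamondop> a \<diamondop> e * b \<diamondop> d)
      - (w \<diamondop> b \<diamondop> d * a \<diamondop> e + w \<diamondop> b \<diamondop> e * a \<diamondop> d)
      + w \<diamondop> b \<diamondop> e \<diamondop> (a \<diamondop> d) + w \<diamondop> b \<diamondop> d \<diamondop> (a \<diamondop> e) + w \<diamondop> b \<diamondop> (a \<diamondop> d \<diamondop> e)"
    by (simp add: commutator_def algebra_simps)
  moreover have "\<dots> \<in> I"
    by (intro add_mem diff_mem left_mem right_mem[OF za] second_centre_swap za zb zab second_centre_derived)
  ultimately show ?thesis by simp
qed

end

lemma two_sided_ideal_zero: "two_sided_ideal {0}"
  by unfold_locales simp_all

section \<open>Induction along words in the generators\<close>

text \<open>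
  A scalar \<open>r\<close> acts as multiplication by the central element \<open>r *s 1\<close>, so this condition implies
  linearity over the ground ring, and it can be checked for compositions of multiplications without
  mentioning the scalar action.
\<close>

definition linear :: "('a::{ring, monoid_mult} \<Rightarrow> 'a) \<Rightarrow> bool" where
  "linear f \<longleftrightarrow> (\<forall>a b. f (a + b) = f a + f b) \<and>
    (\<forall>k a. (\<forall>b. k * b = b * k) \<longrightarrow> f (k * a) = k * f a)"

lemma linear_uminus: "linear f \<Longrightarrow> linear (\<lambda>y. - f y)"
  by (simp add: linear_def)

lemma linear_id: "linear (\<lambda>y. y)"
  by (simp add: linear_def)

lemma linear_plus: "\<lbrakk>linear f; linear g\<rbrakk> \<Longrightarrow> linear (\<lambda>y. f y + g y)"
  by (simp add: linear_def algebra_simps)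

lemma linear_mult_left: "linear f \<Longrightarrow> linear (\<lambda>y. a * f y)"
  unfolding linear_def by (metis distrib_left mult.assoc)

lemma linear_mult_right: "linear f \<Longrightarrow> linear (\<lambda>y. f y * a)"
  by (simp add: linear_def distrib_right mult.assoc)

lemma linear_commutator_left: "linear f \<Longrightarrow> linear (\<lambda>y. a \<diamondop> f y)"
  unfolding commutator_def diff_conv_add_uminus
  by (intro linear_plus linear_mult_left linear_mult_right linear_uminus)

lemma linear_commutator_right: "linear f \<Longrightarrow> linear (\<lambda>y. f y \<diamondop> a)"
  unfolding commutator_def diff_conv_add_uminus
  by (intro linear_plus linear_mult_left linear_mult_right linear_uminus)

lemmas linear_intros = linear_id linear_plus linear_mult_left linear_mult_right
  linear_commutator_left linear_commutator_right

locale generated_algebra = unital_algebra scale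
  for scale :: "'r::{comm_ring, comm_monoid_mult} \<Rightarrow> 'a::{ring, monoid_mult} \<Rightarrow> 'a" (infixr \<open>*s\<close> 75) +
  fixes X :: "'a set"
  assumes generated: "generates scale X"
begin

abbreviation Y where "Y \<equiv> X \<union> pair_products X"

text \<open>
  The elements \<open>p\<close> such that left multiplication by \<open>p\<close> preserves the claim form a subalgebra that
  contains \<open>X\<close>.  A family \<open>f i\<close> rather than a single map is needed when the induction step changes a
  parameter.
\<close>

lemma linear_word_induct:
  assumes "two_sided_ideal I"
    and lin: "\<And>i. linear (f i)"
    and one: "\<And>i. f i 1 \<in> I"
    and mult: "\<And>x y i. \<lbrakk>x \<in> X; \<And>j. f j y \<in> I\<rbrakk> \<Longrightarrow> f i (x * y) \<in> I"
  shows "f i y \<in> I"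
proof -
  interpret two_sided_ideal I by fact
  let ?P = "\<lambda>y. \<forall>i. f i y \<in> I"
  let ?S = "{p. \<forall>y. ?P y \<longrightarrow> ?P (p * y)}"
  have scale: "f i (r *s y) = r *s f i y" for i r y
  proof -
    have "(r *s 1) * b = b * (r *s 1)" for b
      by (simp add: scale_mult_left scale_mult_right)
    then have "f i ((r *s 1) * y) = (r *s 1) * f i y"
      using lin[of i] unfolding linear_def by blast
    then show ?thesis by (simp add: scale_mult_left)
  qed
  have plus: "f i (a + b) = f i a + f i b" for i a b
    using lin[of i] by (simp add: linear_def)
  have "f i 0 = 0" for i using plus[of i 0 0] by simp
  moreover have "r *s t \<in> I" if "t \<in> I" for r t
    using left_mem[OF that, of "r *s 1"] by (simp add: scale_mult_left)
  ultimately have "subalgebra scale ?S"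
    using plus by (auto simp: subalgebra_def scale scale_mult_left distrib_right mult.assoc
        intro: zero_mem add_mem)
  moreover have "X \<subseteq> ?S" using mult by auto
  ultimately have "y \<in> ?S"
    using hull_minimal[of X ?S "subalgebra scale"] generated by (auto simp: generates_def)
  then show ?thesis using one by fastforce
qed

lemma centraliser:
  assumes "two_sided_ideal I" and v: "\<And>x. x \<in> X \<Longrightarrow> v \<diamondop> x \<in> I"
  shows "v \<diamondop> a \<in> I"
proof (rule linear_word_induct[OF assms(1), where f = "\<lambda>_::unit. \<lambda>a. v \<diamondop> a"])
  interpret two_sided_ideal I by fact
  show "v \<diamondop> 1 \<in> I" by (simp add: commutator_def zero_mem)
  show "v \<diamondop> (x * y) \<in> I" if "x \<in> X" and "\<And>_::unit. v \<diamondop> y \<in> I" for x y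
    using that unfolding commutator_mult_right by (intro add_mem right_mem[OF v] left_mem) auto
qed (intro linear_intros)

section \<open>Centrality of commutators from words of length at most two\<close>

text \<open>
  By the Leibniz rule \<open>[w, x y, d]\<close> is the sum of \<open>[w, x] [y, d] + [x, d] [w, y]\<close> and terms that are
  dealt with by induction.  For letters \<open>y \<in> X\<close> the former lies in \<open>I\<close> because \<open>[w, x y, d]\<close> does.
  Prepending a letter \<open>s\<close> to \<open>y\<close> reproduces it up to commuting \<open>s\<close> past \<open>[x, d]\<close>, and this costs
  \<open>[x, d, s] [w, y]\<close>.
\<close>

lemma central_if_triples_annihilate:
  assumes "two_sided_ideal I"
    and test: "\<And>y d. y \<in> Y \<Longrightarrow> w \<diamondop> y \<diamondop> d \<in> I"
    and ann: "\<And>x d s y. \<lbrakk>x \<in> X; d \<in> X; s \<in> X\<rbrakk> \<Longrightarrow> x \<diamondop> d \<diamondop> s * w \<diamondop> y \<in> I"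
  shows "w \<diamondop> y \<diamondop> d \<in> I"
proof -
  interpret two_sided_ideal I by fact
  have pair: "w \<diamondop> x * s \<diamondop> d + x \<diamondop> d * w \<diamondop> s \<in> I" if "x \<in> X" "s \<in> X" for x s d
  proof -
    have "w \<diamondop> x * s \<diamondop> d + x \<diamondop> d * w \<diamondop> s =
        w \<diamondop> (x * s) \<diamondop> d - w \<diamondop> x \<diamondop> d * s - x * w \<diamondop> s \<diamondop> d"
      by (simp add: commutator_def algebra_simps)
    moreover have "\<dots> \<in> I"
      using that by (intro diff_mem left_mem right_mem test) (auto simp: pair_products_def)
    ultimately show ?thesis by simp
  qed
  have cross: "w \<diamondop> x * y \<diamondop> d + x \<diamondop> d * w \<diamondop> y \<in> I" if "x \<in> X" "d \<in> X" for x d y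
  proof (rule linear_word_induct[OF assms(1), where f = "\<lambda>_::unit. \<lambda>y. w \<diamondop> x * y \<diamondop> d + x \<diamondop> d * w \<diamondop> y"])
    show "w \<diamondop> x * 1 \<diamondop> d + x \<diamondop> d * w \<diamondop> 1 \<in> I"
      by (simp add: commutator_def zero_mem)
    fix s y assume s: "s \<in> X" and IH: "\<And>_::unit. w \<diamondop> x * y \<diamondop> d + x \<diamondop> d * w \<diamondop> y \<in> I"
    have "w \<diamondop> x * (s * y) \<diamondop> d + x \<diamondop> d * w \<diamondop> (s * y) =
        (w \<diamondop> x * s \<diamondop> d + x \<diamondop> d * w \<diamondop> s) * y + s * (w \<diamondop> x * y \<diamondop> d + x \<diamondop> d * w \<diamondop> y)
        + w \<diamondop> x \<diamondop> s * y \<diamondop> d + x \<diamondop> d \<diamondop> s * w \<diamondop> y"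
      by (simp add: commutator_def algebra_simps)
    moreover have "\<dots> \<in> I"
      using that s by (intro add_mem left_mem[OF IH] right_mem[OF pair] right_mem[OF test] ann) auto
    ultimately show "w \<diamondop> x * (s * y) \<diamondop> d + x \<diamondop> d * w \<diamondop> (s * y) \<in> I" by simp
  qed (intro linear_intros)
  have "w \<diamondop> y \<diamondop> d \<in> I" if d: "d \<in> X" for y d
  proof (rule linear_word_induct[OF assms(1), where f = "\<lambda>_::unit. \<lambda>y. w \<diamondop> y \<diamondop> d"])
    show "w \<diamondop> 1 \<diamondop> d \<in> I" by (simp add: commutator_def zero_mem)
    fix x y assume x: "x \<in> X" and IH: "\<And>_::unit. w \<diamondop> y \<diamondop> d \<in> I"
    have "w \<diamondop> (x * y) \<diamondop> d =
        (w \<diamondop> x * y \<diamondop> d + x \<diamondop> d * w \<diamondop> y) + w \<diamondop> x \<diamondop> d * y + x * w \<diamondop> y \<diamondop> d"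
      by (simp add: commutator_def algebra_simps)
    moreover have "\<dots> \<in> I"
      using d x by (intro add_mem[OF add_mem] left_mem[OF IH] right_mem[OF test] cross) auto
    ultimately show "w \<diamondop> (x * y) \<diamondop> d \<in> I" by simp
  qed (intro linear_intros)
  then show ?thesis by (rule centraliser[OF assms(1)])
qed

text \<open>
  This is the case \<open>n = 3\<close>.  With \<open>w = x \<in> X\<close> the annihilation hypothesis of the previous lemma holds
  because \<open>[x, d, s] \<in> I\<close> already.  An arbitrary first entry \<open>a\<close> is reduced to entries in \<open>X\<close> by the cyclic identity
  \<open>[a, x b] = [a x, b] + [b a, x]\<close>.
\<close>

lemma class_two:
  assumes "two_sided_ideal I"
    and test: "\<And>x y x'. \<lbrakk>x \<in> X; y \<in> Y; x' \<in> X\<rbrakk> \<Longrightarrow> x \<diamondop> y \<diamondop> x' \<in> I"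
  shows "a \<diamondop> b \<diamondop> c \<in> I"
proof -
  interpret two_sided_ideal I by fact
  have x: "x \<diamondop> y \<diamondop> d \<in> I" if x: "x \<in> X" for x y d
  proof (rule central_if_triples_annihilate[OF assms(1)])
    show "x \<diamondop> y \<diamondop> d \<in> I" if "y \<in> Y" for y d
      by (rule centraliser[OF assms(1) test[OF x that]])
    show "x' \<diamondop> d \<diamondop> s * x \<diamondop> y \<in> I" if "x' \<in> X" "d \<in> X" "s \<in> X" for x' d s y
      using that by (intro right_mem test) auto
  qed
  show ?thesis
  proof (rule linear_word_induct[OF assms(1), where f = "\<lambda>a b. a \<diamondop> b \<diamondop> c"])
    show "a \<diamondop> 1 \<diamondop> c \<in> I" for a by (simp add: commutator_def zero_mem)
    fix x b a assume "x \<in> X" and IH: "\<And>a. a \<diamondop> b \<diamondop> c \<in> I"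
    have "a \<diamondop> (x * b) \<diamondop> c = (a * x) \<diamondop> b \<diamondop> c - x \<diamondop> (b * a) \<diamondop> c"
      by (simp add: commutator_def algebra_simps)
    moreover have "\<dots> \<in> I" using \<open>x \<in> X\<close> by (intro diff_mem IH x)
    ultimately show "a \<diamondop> (x * b) \<diamondop> c \<in> I" by simp
  qed (intro linear_intros)
qed

end

section \<open>Annihilation of triple commutators\<close>

locale third_generated_algebra = generated_algebra scale X
  for scale :: "'r::{comm_ring, comm_monoid_mult} \<Rightarrow> 'a::{ring, monoid_mult} \<Rightarrow> 'a" (infixr \<open>*s\<close> 75)
    and X :: "'a set" +
  assumes third: "\<exists>u::'r. (1 + 1 + 1) * u = 1"
begin

lemma third_mem:
  fixes t :: 'a
  assumes "two_sided_ideal I" "t + t + t \<in> I"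
  shows "t \<in> I"
proof -
  obtain u :: 'r where u: "(1 + 1 + 1) * u = 1" using third by blast
  have "(u *s 1) * (t + t + t) = (u + u + u) *s t"
    by (simp add: scale_mult_left scale_right_distrib scale_left_distrib)
  also have "u + u + u = 1" using u by (simp add: distrib_right)
  finally show ?thesis
    using two_sided_ideal.left_mem[OF assms, of "u *s 1"] by (simp add: scale_one)
qed

text \<open>
  The symmetries behind the case of a middle entry from \<open>X\<^sup>2\<close> are as follows, all modulo
  \<open>I\<close>.  Once the products \<open>[w, c] [a, b, d]\<close> on letters vanish, \<open>V c a b p q = [w, c] [a, p q, b]\<close> equals
  \<open>[w, c] ([a, p] [q, b] + [p, b] [a, q])\<close>, where the two commutators in each product may be
  interchanged.  So \<open>V c a b p q\<close> is symmetric in \<open>a\<close>, \<open>b\<close>, invariant under \<open>(a, b) \<leftrightarrow> (p, q)\<close>,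
  and antisymmetric in \<open>c\<close>, \<open>a\<close> by the exchange rule.  Together these give
  \<open>V c a b p q = - V c a q p b = - V c a p b q\<close>, whereas the sum of the three values, one for each way
  of splitting \<open>a\<close>, \<open>b\<close>, \<open>p\<close>, \<open>q\<close> into two pairs, vanishes because the commutators are
  antisymmetric.  Hence each of them is zero.
\<close>

lemma annihilates_triple:
  assumes "two_sided_ideal I"
    and test: "\<And>y p q. y \<in> Y \<Longrightarrow> w \<diamondop> y \<diamondop> p \<diamondop> q \<in> I"
    and c: "c \<in> X"
  shows "w \<diamondop> c * p \<diamondop> q \<diamondop> r \<in> I"
proof -
  interpret two_sided_ideal I by fact
  define N where "N = {t. \<forall>c\<in>X. \<forall>b. w \<diamondop> c * b * t \<in> I}"
  have N: "two_sided_ideal N"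
  proof
    show "0 \<in> N" by (simp add: N_def zero_mem)
    show "s + t \<in> N" if "s \<in> N" "t \<in> N" for s t
      using that by (simp add: N_def distrib_left add_mem)
    show "b * t \<in> N" if "t \<in> N" for b t
      using that by (simp add: N_def) (metis mult.assoc)
    show "t * b \<in> N" if "t \<in> N" for b t
      using that by (simp add: N_def) (metis mult.assoc right_mem)
  qed
  interpret N: two_sided_ideal N by (rule N)
  have NI: "w \<diamondop> c * t \<in> I" if "t \<in> N" "c \<in> X" for c t
    using that unfolding N_def by (metis (mono_tags, lifting) mem_Collect_eq mult.right_neutral)
  \<comment> \<open>For a triple commutator \<open>t\<close> the factor \<open>b\<close> in the definition of \<open>N\<close> can be dropped, because
    \<open>[w, c, b]\<close> annihilates \<open>t\<close> by lemma \<open>second_centre_triple\<close>.\<close>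
  have IN: "p \<diamondop> q \<diamondop> r \<in> N" if *: "\<And>c. c \<in> X \<Longrightarrow> w \<diamondop> c * p \<diamondop> q \<diamondop> r \<in> I" for p q r
  proof -
    have "w \<diamondop> c * b * p \<diamondop> q \<diamondop> r \<in> I" if c: "c \<in> X" for c b
    proof -
      have "w \<diamondop> c * b * p \<diamondop> q \<diamondop> r = b * (w \<diamondop> c * p \<diamondop> q \<diamondop> r) + w \<diamondop> c \<diamondop> b * p \<diamondop> q \<diamondop> r"
        by (simp add: commutator_def algebra_simps)
      moreover have "w \<diamondop> c \<diamondop> b * p \<diamondop> q \<diamondop> r \<in> I"
        using test c by (intro second_centre_triple) auto
      ultimately show ?thesis using *[OF c] by (simp add: add_mem left_mem)
    qed
    then show ?thesis by (simp add: N_def)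
  qed
  have exchange: "w \<diamondop> a * b \<diamondop> d \<diamondop> e + w \<diamondop> b * a \<diamondop> d \<diamondop> e \<in> I" if "a \<in> X" "b \<in> X" for a b d e
    using that by (intro second_centre_exchange test) (auto simp: pair_products_def)
  have "w \<diamondop> c * a \<diamondop> b \<diamondop> d \<in> I" if "c \<in> X" "a \<in> X" "b \<in> X" "d \<in> X" for c a b d
    by (rule alternating_Jacobi[where u = "\<lambda>c. w \<diamondop> c" and X = X,
          OF third_mem[OF assms(1)] exchange that])
  then have letters: "a \<diamondop> b \<diamondop> d \<in> N" if "a \<in> X" "b \<in> X" "d \<in> X" for a b d
    using that by (intro IN)
  define V where "V c a b p q = w \<diamondop> c * a \<diamondop> (p * q) \<diamondop> b" for c a b p q
  define W where "W c x y z t = w \<diamondop> c * (x \<diamondop> y) * (z \<diamondop> t)" for c x y z t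
  have W_commute: "W c x y z t - W c z t x y \<in> I"
    if "c \<in> X" "x \<in> X" "y \<in> X" "z \<in> X" "t \<in> X" for c x y z t
  proof -
    have "W c x y z t - W c z t x y = w \<diamondop> c * x \<diamondop> y \<diamondop> z \<diamondop> t - w \<diamondop> c * x \<diamondop> y \<diamondop> t \<diamondop> z"
      by (simp add: W_def commutator_def algebra_simps)
    then show ?thesis using that by (simp only:) (intro diff_mem NI N.commutator_right[OF letters])
  qed
  have V_W: "V c a b p q - (W c a p q b + W c p b a q) \<in> I"
    if "c \<in> X" "a \<in> X" "b \<in> X" "p \<in> X" "q \<in> X" for c a b p q
  proof -
    have "V c a b p q - (W c a p q b + W c p b a q) =
        w \<diamondop> c * (a \<diamondop> p \<diamondop> b * q) + w \<diamondop> c * (p * a \<diamondop> q \<diamondop> b)"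
      by (simp add: V_def W_def commutator_def algebra_simps)
    then show ?thesis using that by (simp only:) (intro add_mem NI N.left_mem[OF letters] N.right_mem[OF letters])
  qed
  have V_exchange: "V c a b p q + V a c b p q \<in> I" if "c \<in> X" "a \<in> X" for c a b p q
    using exchange that by (simp add: V_def)
  have V_sym: "V c a b p q - V c b a p q \<in> I"
    if "c \<in> X" "a \<in> X" "b \<in> X" "p \<in> X" "q \<in> X" for c a b p q
  proof -
    have "V c a b p q - V c b a p q =
        (V c a b p q - (W c a p q b + W c p b a q)) - (V c b a p q - (W c b p q a + W c p a b q))"
      by (simp add: W_def commutator_def algebra_simps)
    then show ?thesis using that by (simp only:) (intro diff_mem V_W)
  qed
  have V_flip: "V c a b p q - V c p q a b \<in> I"
    if "c \<in> X" "a \<in> X" "b \<in> X" "p \<in> X" "q \<in> X" for c a b p q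
  proof -
    have "V c a b p q - V c p q a b =
        (V c a b p q - (W c a p q b + W c p b a q)) - (V c p q a b - (W c p a b q + W c a q p b))
        + (W c p b a q - W c a q p b)"
      by (simp add: W_def commutator_def algebra_simps)
    then show ?thesis using that by (simp only:) (intro add_mem diff_mem V_W W_commute)
  qed
  \<comment> \<open>The front letter runs through \<open>c\<close>, \<open>p\<close>, \<open>a\<close> and back to \<open>c\<close>: three exchanges, each preceded by a
    flip, hence the sign.\<close>
  have V_rotate: "V c a b p q + V c a q p b \<in> I"
    if "c \<in> X" "a \<in> X" "b \<in> X" "p \<in> X" "q \<in> X" for c a b p q
  proof -
    have "V c a b p q + V c a q p b =
        (V c a b p q - V c p q a b) + (V c p q a b + V p c q a b) - (V p c q a b - V p a b c q)
        - (V p a b c q + V a p b c q) + (V a p b c q - V a c q p b) + (V a c q p b + V c a q p b)"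
      by simp
    then show ?thesis using that by (simp only:) (intro add_mem diff_mem V_flip V_exchange)
  qed
  have V_sum: "V c a b p q + V c a p b q + V c a q p b \<in> I"
    if "c \<in> X" "a \<in> X" "b \<in> X" "p \<in> X" "q \<in> X" for c a b p q
  proof -
    have "V c a b p q + V c a p b q + V c a q p b =
        (V c a b p q - (W c a p q b + W c p b a q)) + (V c a p b q - (W c a b q p + W c b p a q))
        + (V c a q p b - (W c a p b q + W c p q a b)) - (W c a b p q - W c p q a b)"
      by (simp add: W_def commutator_def algebra_simps)
    then show ?thesis using that by (simp only:) (intro add_mem diff_mem V_W W_commute)
  qed
  have V: "V c a b p q \<in> I"
    if X: "c \<in> X" "a \<in> X" "b \<in> X" "p \<in> X" "q \<in> X" for c a b p q
  proof -
    let ?sum = "(V c a b p q + V c a q p b) + (V c a b q p + V c a p q b)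
        + (V c a b p q - V c p q a b) + (V c p q a b - V c q p a b) - (V c a b q p - V c q p a b)
        - (V c a p q b - V c q b a p) - (V c q b a p - V c b q a p) + (V c a p b q - V c b q a p)
        - (V c a b p q + V c a p b q + V c a q p b)"
    have "?sum \<in> I"
      by (intro diff_mem[OF add_mem[OF diff_mem[OF diff_mem[OF diff_mem[OF add_mem[OF add_mem[OF
          add_mem[OF V_rotate V_rotate] V_flip] V_sym] V_flip] V_flip] V_sym] V_flip] V_sum] X)
    moreover have "?sum = V c a b p q" by simp
    ultimately show ?thesis by (simp only:)
  qed
  have "x \<diamondop> y \<diamondop> x' \<in> N" if "x \<in> X" "y \<in> Y" "x' \<in> X" for x y x'
    using that letters V IN by (auto simp: pair_products_def V_def)
  then have "p \<diamondop> q \<diamondop> r \<in> N" by (rule class_two[OF N])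
  then show ?thesis by (rule NI) (rule c)
qed

text \<open>
  Here \<open>[w, x]\<close> is central modulo \<open>I\<close> for \<open>x \<in> X\<close> and annihilates triple commutators, so that in
  \<open>t b [w, y]\<close>, for a triple commutator \<open>t\<close> on letters, each \<open>[w, x]\<close> coming from the Leibniz expansion
  of \<open>[w, y]\<close> can be moved to the front and meets \<open>t\<close>.
\<close>

lemma central_from_pairs:
  assumes "two_sided_ideal I"
    and test: "\<And>y d. y \<in> Y \<Longrightarrow> w \<diamondop> y \<diamondop> d \<in> I"
  shows "w \<diamondop> y \<diamondop> d \<in> I"
proof (rule central_if_triples_annihilate[OF assms])
  interpret two_sided_ideal I by fact
  have z: "w \<diamondop> x * p \<diamondop> q \<diamondop> r \<in> I" if "x \<in> X" for x p q r
    by (rule annihilates_triple[OF assms(1) commutator_right[OF test] that])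
  fix x d s y assume "x \<in> X" "d \<in> X" "s \<in> X"
  let ?t = "x \<diamondop> d \<diamondop> s"
  have "?t * b * w \<diamondop> y \<in> I" for b
  proof (rule linear_word_induct[OF assms(1), where f = "\<lambda>b y. ?t * b * w \<diamondop> y"])
    show "?t * b * w \<diamondop> 1 \<in> I" for b by (simp add: commutator_def zero_mem)
    fix x' y b assume x: "x' \<in> X" and IH: "\<And>b. ?t * b * w \<diamondop> y \<in> I"
    have "?t * b * w \<diamondop> (x' * y) =
        (w \<diamondop> x' * ?t) * b * y - w \<diamondop> x' \<diamondop> (?t * b) * y + ?t * (b * x') * w \<diamondop> y"
      by (simp add: commutator_def[of "w \<diamondop> x'"] commutator_mult_right algebra_simps)
    moreover have "\<dots> \<in> I"
      using x by (intro add_mem diff_mem right_mem[OF test] right_mem[OF right_mem[OF z]] IH) auto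
    ultimately show "?t * b * w \<diamondop> (x' * y) \<in> I" by simp
  qed (intro linear_intros)
  from this[of 1] show "?t * w \<diamondop> y \<in> I" by simp
qed

end

section \<open>The induction on the length\<close>

text \<open>
  \<open>test_commutators X m\<close> consists of the test commutators of length \<open>m + 1\<close> without the restriction
  that the last entry be a letter, since the induction appends further entries;
  \<open>long_commutators m\<close> likewise has length \<open>m + 1\<close>.
\<close>

primrec test_commutators :: "'a::{ring, monoid_mult} set \<Rightarrow> nat \<Rightarrow> 'a set" where
  "test_commutators X 0 = X"
| "test_commutators X (Suc m) = {g \<diamondop> y | g y. g \<in> test_commutators X m \<and> y \<in> X \<union> pair_products X}"

primrec long_commutators :: "nat \<Rightarrow> 'a::{ring, monoid_mult} set" where
  "long_commutators 0 = UNIV"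
| "long_commutators (Suc m) = {v \<diamondop> a | v a. v \<in> long_commutators m}"

context third_generated_algebra
begin

text \<open>
  In the induction step the hypothesis is applied to the ideal \<open>J\<close> of all \<open>t\<close> whose multiples
  \<open>a t b\<close> satisfy \<open>[a t b, c, d] \<in> I\<close>.  It contains the shorter test commutators by lemma
  \<open>sandwich\<close>, and its very definition turns \<open>v \<in> J\<close> into \<open>[v, c, d] \<in> I\<close>.
\<close>

lemma long_commutators_in_ideal:
  assumes "two_sided_ideal I"
    and "\<And>g x. \<lbrakk>g \<in> test_commutators X m; x \<in> X\<rbrakk> \<Longrightarrow> g \<diamondop> x \<in> I"
    and "v \<in> long_commutators m"
  shows "v \<diamondop> a \<in> I"
  using assms
proof (induction m arbitrary: I v a rule: induct_nat_012)
  case 0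
  interpret two_sided_ideal I by fact
  have letters: "x \<diamondop> x' \<in> I" if "x \<in> X" "x' \<in> X" for x x'
    using 0(2) that by simp
  have "x \<diamondop> v \<in> I" if "x \<in> X" for x
    by (rule centraliser[OF 0(1) letters[OF that]])
  then show ?case by (rule centraliser[OF 0(1) commutator_swap])
next
  case 1
  have "x \<diamondop> y \<diamondop> x' \<in> I" if "x \<in> X" "y \<in> Y" "x' \<in> X" for x y x'
    using that by (intro 1(2)) auto
  then have "b \<diamondop> c \<diamondop> a \<in> I" for b c
    by (rule class_two[OF 1(1)])
  then show ?case using 1(3) by auto
next
  case (ge2 m)
  interpret two_sided_ideal I by fact
  define J where "J = {t. \<forall>a b c d. (a * t * b) \<diamondop> c \<diamondop> d \<in> I}"
  have J: "two_sided_ideal J"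
  proof
    show "0 \<in> J" by (simp add: J_def commutator_def zero_mem)
    show "s + t \<in> J" if "s \<in> J" "t \<in> J" for s t
    proof -
      have "(a * (s + t) * b) \<diamondop> c \<diamondop> d = (a * s * b) \<diamondop> c \<diamondop> d + (a * t * b) \<diamondop> c \<diamondop> d" for a b c d
        by (simp add: commutator_def algebra_simps)
      then show ?thesis using that by (simp add: J_def add_mem)
    qed
    show "p * t \<in> J" if "t \<in> J" for p t
      using that by (simp add: J_def) (metis mult.assoc)
    show "t * p \<in> J" if "t \<in> J" for p t
      using that by (simp add: J_def) (metis mult.assoc)
  qed
  have "g \<diamondop> x \<in> J" if g: "g \<in> test_commutators X m" and x: "x \<in> X" for g x
  proof -
    have test: "g \<diamondop> y \<diamondop> y' \<diamondop> d \<in> I" if "y \<in> Y" "y' \<in> Y" for y y' d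
    proof (rule centraliser[OF ge2(3)])
      have "g \<diamondop> y \<diamondop> y' \<in> test_commutators X (Suc (Suc m))" using g that by auto
      then show "g \<diamondop> y \<diamondop> y' \<diamondop> x \<in> I" if "x \<in> X" for x using that by (rule ge2(4))
    qed
    have z: "g \<diamondop> y \<diamondop> p \<diamondop> q \<in> I" if "y \<in> Y" for y p q
      by (rule central_from_pairs[OF ge2(3) test[OF that]])
    have "g \<diamondop> x * p \<diamondop> q \<diamondop> r \<in> I" for p q r
      by (rule annihilates_triple[OF ge2(3) z x])
    moreover have "g \<diamondop> x \<diamondop> p \<diamondop> q \<in> I" for p q
      using x by (intro z) simp
    ultimately have "(a * (g \<diamondop> x) * b) \<diamondop> c \<diamondop> d \<in> I" for a b c d
      by (intro sandwich)
    then show ?thesis by (simp add: J_def)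
  qed
  note J_test = this
  have J_all: "u \<diamondop> b \<in> J" if "u \<in> long_commutators m" for u b
    by (rule ge2(1)[OF J J_test that])
  obtain u b c where v: "v = u \<diamondop> b \<diamondop> c" and u: "u \<in> long_commutators m"
    using ge2(5) by auto
  have "(1 * (u \<diamondop> b) * 1) \<diamondop> c \<diamondop> a \<in> I"
    using J_all[OF u] unfolding J_def by blast
  then show ?case by (simp add: v)
qed

end

lemma test_commutators_left_normed:
  assumes "g \<in> test_commutators X m"
  shows "\<exists>ys. length ys = Suc m \<and> ys ! 0 \<in> X \<and>
    (\<forall>i. 0 < i \<and> i < Suc m \<longrightarrow> ys ! i \<in> X \<union> pair_products X) \<and> left_normed ys = g"
  using assms
proof (induction m arbitrary: g)
  case 0
  then show ?case by (intro exI[of _ "[g]"]) (simp add: left_normed_def)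
next
  case (Suc m)
  then obtain h y where g: "g = h \<diamondop> y" "h \<in> test_commutators X m" "y \<in> X \<union> pair_products X"
    by auto
  with Suc.IH obtain ys where ys: "length ys = Suc m" "ys ! 0 \<in> X"
    "\<forall>i. 0 < i \<and> i < Suc m \<longrightarrow> ys ! i \<in> X \<union> pair_products X" "left_normed ys = h"
    by blast
  have "left_normed (ys @ [y]) = g"
    using ys g by (subst left_normed_snoc) auto
  moreover have "\<forall>i. 0 < i \<and> i < Suc (Suc m) \<longrightarrow> (ys @ [y]) ! i \<in> X \<union> pair_products X"
    using ys(1,3) g(3) by (simp add: nth_append less_Suc_eq)
  ultimately show ?case
    using ys(1,2) by (intro exI[of _ "ys @ [y]"]) (simp add: nth_append)
qed

lemma left_normed_long_commutators:
  "length as = Suc m \<Longrightarrow> left_normed as \<in> long_commutators m"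
proof (induction m arbitrary: as)
  case (Suc m)
  then obtain bs b where as: "as = bs @ [b]" "length bs = Suc m"
    by (metis length_Suc_conv_rev)
  then have "left_normed as = left_normed bs \<diamondop> b"
    by (subst as(1), subst left_normed_snoc) auto
  then show ?case using Suc.IH[OF as(2)] by auto
qed simp

theorem theorem1p1:
  fixes scale :: "'r::{comm_ring, comm_monoid_mult} \<Rightarrow> 'a::{ring, monoid_mult} \<Rightarrow> 'a"
    and X :: "'a set" and n :: nat
  assumes "unital_algebra scale"
    and "\<exists>u::'r. (1 + 1 + 1) * u = 1"
    and "generates scale X"
    and "n \<ge> 2"
  shows "(\<forall>as::'a list. length as = n \<longrightarrow> left_normed as = 0) \<longleftrightarrow>
    (\<forall>ys::'a list. length ys = n \<and> ys ! 0 \<in> X \<and> ys ! (n - 1) \<in> X \<and>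
        (\<forall>i. 0 < i \<and> i < n - 1 \<longrightarrow> ys ! i \<in> X \<union> pair_products X)
      \<longrightarrow> left_normed ys = 0)"
    (is "?nilpotent \<longleftrightarrow> ?test")
proof
  assume ?nilpotent
  then show ?test by blast
next
  assume test: ?test
  interpret third_generated_algebra scale X
    by (intro third_generated_algebra.intro third_generated_algebra_axioms.intro
        generated_algebra.intro generated_algebra_axioms.intro assms(1-3))
  obtain m where n: "n = Suc (Suc m)"
    using assms(4) that[of "n - 2"] by simp
  have test_zero: "g \<diamondop> x \<in> {0}" if g: "g \<in> test_commutators X m" and x: "x \<in> X" for g x
  proof -
    obtain ys where ys: "length ys = Suc m" "ys ! 0 \<in> X"
      "\<forall>i. 0 < i \<and> i < Suc m \<longrightarrow> ys ! i \<in> X \<union> pair_products X" "left_normed ys = g"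
      using test_commutators_left_normed[OF g] by blast
    then have "left_normed (ys @ [x]) = g \<diamondop> x"
      by (subst left_normed_snoc) auto
    moreover have "length (ys @ [x]) = n \<and> (ys @ [x]) ! 0 \<in> X \<and> (ys @ [x]) ! (n - 1) \<in> X \<and>
        (\<forall>i. 0 < i \<and> i < n - 1 \<longrightarrow> (ys @ [x]) ! i \<in> X \<union> pair_products X)"
      using ys(1-3) x n by (simp add: nth_append)
    then have "left_normed (ys @ [x]) = 0" using test by blast
    ultimately show ?thesis by simp
  qed
  have all: "v \<diamondop> a \<in> {0}" if "v \<in> long_commutators m" for v a :: 'a
    by (rule long_commutators_in_ideal[OF two_sided_ideal_zero test_zero that])
  show ?nilpotent
  proof (intro allI impI)
    fix as :: "'a list" assume "length as = n"
    then obtain bs b where as: "as = bs @ [b]" "length bs = Suc m"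
      using n by (metis length_Suc_conv_rev)
    then have "left_normed as = left_normed bs \<diamondop> b"
      by (subst as(1), subst left_normed_snoc) auto
    then show "left_normed as = 0"
      using all[OF left_normed_long_commutators[OF as(2)]] by simp
  qed
qed

end
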